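(* For a variety $\mathbf{V}$ of Boolean frames let $\mathbf{V}^*=\mathbf{HSP}\{\mathfrak{A}^*:\mathfrak{A}\in\mathbf{V}\}$. Let $\mathbf{V}$ and $\mathbf{U}$ be different varieties of normal and unit-preserving Boolean frames. Then $\mathbf{V}^*$ and $\mathbf{U}^*$ are different varieties, and both lack the congruence extension property.
   Context: A Boolean frame is an algebra $\langle A,\sqcap,-,0,f\rangle$ with $\langle A,\sqcap,-,0\rangle$ a Boolean algebra and $f:A\to A$ an arbitrary unary operation; it is normal if $f(0)=0$ and unit-preserving if $f(1)=1$. For a Boolean frame $\mathfrak{A}$, $\mathfrak{A}^*$ is the Boolean frame whose Boolean reduct is the direct product of two copies of the Boolean reduct of $\mathfrak{A}$ (universe $A\times A$) and whose operation is $f^*(\langle a,b\rangle)=\langle f(a),f(b)\rangle$ if $a=0$ or $b=0$, and $f^*(\langle a,b\rangle)=\langle1,1\rangle$ otherwise. $\mathbf{HSP}(K)$ is the variety generated by the class $K$. An algebra has the congruence extension property (CEP) if for every subalgebra $B$ and every congruence $\Theta$ of $B$ there is a congruence $\Psi$ of the algebra with $\Psi\cap(B\times B)=\Theta$; a variety lacks CEP if some member lacks it.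
   Formalization: Failure of the congruence extension property is claimed for V* (resp. U* ) only if V (resp. U) is nontrivial, since the star of the trivial variety is trivial and has CEP; varieties are represented by their members over an arbitrary infinite set, which determines them. *)

theory Defs
  imports "HOL-Library.FuncSet"
begin

record 'a frame =
  univ :: "'a set"
  meet :: "'a \<Rightarrow> 'a \<Rightarrow> 'a"
  compl :: "'a \<Rightarrow> 'a"
  zero :: "'a"
  oper :: "'a \<Rightarrow> 'a"

definition join :: "'a frame \<Rightarrow> 'a \<Rightarrow> 'a \<Rightarrow> 'a" where
  "join A x y = compl A (meet A (compl A x) (compl A y))"

definition one :: "'a frame \<Rightarrow> 'a" where
  "one A = compl A (zero A)"

text \<open>One-element algebras are admitted, as they have to be for varieties of Boolean frames to exist.\<close>

definition boolean_frame :: "'a frame \<Rightarrow> bool" where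
  "boolean_frame A \<longleftrightarrow>
     zero A \<in> univ A \<and>
     (\<forall>x\<in>univ A. compl A x \<in> univ A \<and> oper A x \<in> univ A) \<and>
     (\<forall>x\<in>univ A. \<forall>y\<in>univ A. meet A x y \<in> univ A) \<and>
     (\<forall>x\<in>univ A. \<forall>y\<in>univ A. meet A x y = meet A y x \<and> join A x y = join A y x) \<and>
     (\<forall>x\<in>univ A. \<forall>y\<in>univ A. \<forall>z\<in>univ A.
        meet A (meet A x y) z = meet A x (meet A y z) \<and>
        join A (join A x y) z = join A x (join A y z)) \<and>
     (\<forall>x\<in>univ A. \<forall>y\<in>univ A. meet A x (join A x y) = x \<and> join A x (meet A x y) = x) \<and>
     (\<forall>x\<in>univ A. \<forall>y\<in>univ A. \<forall>z\<in>univ A.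
        meet A x (join A y z) = join A (meet A x y) (meet A x z) \<and>
        join A x (meet A y z) = meet A (join A x y) (join A x z)) \<and>
     (\<forall>x\<in>univ A. meet A x (compl A x) = zero A \<and> join A x (compl A x) = one A)"

definition normal :: "'a frame \<Rightarrow> bool" where
  "normal A \<longleftrightarrow> oper A (zero A) = zero A"

definition unit_preserving :: "'a frame \<Rightarrow> bool" where
  "unit_preserving A \<longleftrightarrow> oper A (one A) = one A"

definition star :: "'a frame \<Rightarrow> ('a \<times> 'a) frame" where
  "star A = \<lparr>univ = univ A \<times> univ A,
     meet = (\<lambda>(a, b) (c, d). (meet A a c, meet A b d)),
     compl = (\<lambda>(a, b). (compl A a, compl A b)),
     zero = (zero A, zero A),
     oper = (\<lambda>(a, b). if a = zero A \<or> b = zero A then (oper A a, oper A b)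
                       else (one A, one A))\<rparr>"

definition subuniverse :: "'a set \<Rightarrow> 'a frame \<Rightarrow> bool" where
  "subuniverse C A \<longleftrightarrow> C \<subseteq> univ A \<and> zero A \<in> C \<and>
     (\<forall>x\<in>C. compl A x \<in> C \<and> oper A x \<in> C) \<and> (\<forall>x\<in>C. \<forall>y\<in>C. meet A x y \<in> C)"

definition subalgebra :: "'a frame \<Rightarrow> 'a frame \<Rightarrow> bool" where
  "subalgebra B A \<longleftrightarrow> (\<exists>C. subuniverse C A \<and> B = A\<lparr>univ := C\<rparr>)"

definition product :: "'i set \<Rightarrow> ('i \<Rightarrow> 'a frame) \<Rightarrow> ('i \<Rightarrow> 'a) frame" where
  "product I A = \<lparr>univ = (\<Pi>\<^sub>E i\<in>I. univ (A i)),
     meet = (\<lambda>x y. \<lambda>i\<in>I. meet (A i) (x i) (y i)),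
     compl = (\<lambda>x. \<lambda>i\<in>I. compl (A i) (x i)),
     zero = (\<lambda>i\<in>I. zero (A i)),
     oper = (\<lambda>x. \<lambda>i\<in>I. oper (A i) (x i))\<rparr>"

definition hom_onto :: "('a \<Rightarrow> 'b) \<Rightarrow> 'a frame \<Rightarrow> 'b frame \<Rightarrow> bool" where
  "hom_onto h B A \<longleftrightarrow> h ` univ B = univ A \<and> h (zero B) = zero A \<and>
     (\<forall>x\<in>univ B. h (compl B x) = compl A (h x) \<and> h (oper B x) = oper A (h x)) \<and>
     (\<forall>x\<in>univ B. \<forall>y\<in>univ B. h (meet B x y) = meet A (h x) (h y))"

definition opP :: "'a frame set \<Rightarrow> ('i \<Rightarrow> 'a) frame set" where
  "opP K = {product I A |I A. \<forall>i\<in>I. A i \<in> K}"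

definition opS :: "'a frame set \<Rightarrow> 'a frame set" where
  "opS K = {B. \<exists>A\<in>K. subalgebra B A}"

definition opH :: "'a frame set \<Rightarrow> 'b frame set" where
  "opH K = {A. \<exists>B\<in>K. \<exists>h. hom_onto h B A}"

text \<open>
  \<^term>\<open>HSP K\<close> collects the members of the variety generated by \<^term>\<open>K\<close> whose elements come from
  a given type. The products may live in larger types. Their index type is the one needed for
  the canonical construction (pairs of a factor and a valuation in it); the lemma
  \<open>HSP_any_index\<close> below shows that no other index type yields further algebras.
\<close>

definition HSP :: "'k frame set \<Rightarrow> 'a frame set" where
  "HSP K = opH (opS (opP K :: ((('a \<Rightarrow> 'k) \<times> 'k frame) \<Rightarrow> 'k) frame set))"

text \<open>
  A variety is represented by its members with elements in a type \<open>'u\<close>. When \<open>'u\<close> is infinite,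
  this is a faithful representation: a variety is determined by its countable members, and the
  sets with \<^prop>\<open>HSP V = V\<close> are exactly the traces on \<open>'u\<close> of varieties of arbitrary algebras.
\<close>

definition variety :: "'u frame set \<Rightarrow> bool" where
  "variety V \<longleftrightarrow> (\<forall>A\<in>V. boolean_frame A) \<and> HSP V = V"

definition star_variety :: "'u frame set \<Rightarrow> 'u frame set" where
  "star_variety V = HSP (star ` V)"

definition congruence :: "'a frame \<Rightarrow> ('a \<times> 'a) set \<Rightarrow> bool" where
  "congruence A \<Theta> \<longleftrightarrow> equiv (univ A) \<Theta> \<and>
     (\<forall>x y. (x, y) \<in> \<Theta> \<longrightarrow> (compl A x, compl A y) \<in> \<Theta> \<and> (oper A x, oper A y) \<in> \<Theta>) \<and>
     (\<forall>x y x' y'. (x, y) \<in> \<Theta> \<and> (x', y') \<in> \<Theta> \<longrightarrow> (meet A x x', meet A y y') \<in> \<Theta>)"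

definition has_CEP :: "'a frame \<Rightarrow> bool" where
  "has_CEP A \<longleftrightarrow> (\<forall>B \<Theta>. subalgebra B A \<and> congruence B \<Theta> \<longrightarrow>
     (\<exists>\<Psi>. congruence A \<Psi> \<and> \<Psi> \<inter> (univ B \<times> univ B) = \<Theta>))"

definition lacks_CEP :: "'a frame set \<Rightarrow> bool" where
  "lacks_CEP V \<longleftrightarrow> (\<exists>A\<in>V. \<not> has_CEP A)"

definition nontrivial :: "'a frame set \<Rightarrow> bool" where
  "nontrivial V \<longleftrightarrow> (\<exists>A\<in>V. \<exists>x\<in>univ A. \<exists>y\<in>univ A. x \<noteq> y)"

lemma HSP_any_index:
  fixes K :: "'k frame set" and A :: "'a frame"
  assumes "A \<in> opH (opS (opP K :: ('j \<Rightarrow> 'k) frame set))"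
  shows "A \<in> HSP K"
proof -
  from assms obtain J :: "'j set" and B C h
    where B: "\<forall>j\<in>J. B j \<in> K" and C: "subuniverse C (product J B)"
      and h: "hom_onto h ((product J B)\<lparr>univ := C\<rparr>) A"
    unfolding opH_def opS_def opP_def subalgebra_def by blast
  have img: "h ` C = univ A" using h by (simp add: hom_onto_def)
  define s where "s a = (SOME x. x \<in> C \<and> h x = a)" for a
  have s: "s a \<in> C \<and> h (s a) = a" if "a \<in> univ A" for a
  proof -
    from that have "a \<in> h ` C" by (simp add: img)
    then have "\<exists>x. x \<in> C \<and> h x = a" by (auto elim: imageE)
    from someI_ex[OF this] show ?thesis by (simp add: s_def)
  qed
  define \<phi> where "\<phi> j = ((\<lambda>a. if a \<in> univ A then s a j else undefined), B j)" for j
  define I where "I = \<phi> ` J"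
  define up where "up y = (\<lambda>j\<in>J. y (\<phi> j))" for y :: "('a \<Rightarrow> 'k) \<times> 'k frame \<Rightarrow> 'k"
  define D where "D = {y \<in> univ (product I snd). up y \<in> C}"
  have sB: "snd (\<phi> j) = B j" for j by (simp add: \<phi>_def)
  have up_zero: "up (zero (product I snd)) = zero (product J B)"
    by (auto simp: up_def product_def I_def sB fun_eq_iff restrict_def)
  have up_compl: "up (compl (product I snd) y) = compl (product J B) (up y)" for y
    by (auto simp: up_def product_def I_def sB fun_eq_iff restrict_def)
  have up_oper: "up (oper (product I snd) y) = oper (product J B) (up y)" for y
    by (auto simp: up_def product_def I_def sB fun_eq_iff restrict_def)
  have up_meet: "up (meet (product I snd) y z) = meet (product J B) (up y) (up z)" for y z
    by (auto simp: up_def product_def I_def sB fun_eq_iff restrict_def)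
  have mem: "y \<in> univ (product I snd)" if "up y \<in> C" "y \<in> extensional I" for y
  proof -
    have "up y \<in> univ (product J B)" using C that(1) by (auto simp: subuniverse_def)
    then have "y (\<phi> j) \<in> univ (B j)" if "j \<in> J" for j
      using that by (auto simp: product_def up_def PiE_iff)
    then show ?thesis using that(2) by (auto simp: product_def PiE_iff I_def sB)
  qed
  have exten: "zero (product I snd) \<in> extensional I" "compl (product I snd) y \<in> extensional I"
    "oper (product I snd) y \<in> extensional I" "meet (product I snd) y z \<in> extensional I" for y z
    by (auto simp: product_def)
  have closed: "zero (product J B) \<in> C" "\<And>x. x \<in> C \<Longrightarrow> compl (product J B) x \<in> C"
    "\<And>x. x \<in> C \<Longrightarrow> oper (product J B) x \<in> C"
    "\<And>x y. x \<in> C \<Longrightarrow> y \<in> C \<Longrightarrow> meet (product J B) x y \<in> C"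
    using C by (auto simp: subuniverse_def)
  have D: "subuniverse D (product I snd)"
    unfolding subuniverse_def D_def
    using closed by (simp add: mem exten up_zero up_compl up_oper up_meet)
  have onto: "(h \<circ> up) ` D = univ A"
  proof
    show "(h \<circ> up) ` D \<subseteq> univ A" using img by (auto simp: D_def)
    show "univ A \<subseteq> (h \<circ> up) ` D"
    proof
      fix a assume a: "a \<in> univ A"
      define y where "y = (\<lambda>i\<in>I. fst i a)"
      have "s a \<in> univ (product J B)" using C s[OF a] by (auto simp: subuniverse_def)
      then have "s a \<in> extensional J" by (simp add: product_def PiE_iff)
      then have "up y = s a"
        using a by (auto simp: up_def y_def I_def \<phi>_def fun_eq_iff extensional_def)
      then have "y \<in> D" using s[OF a] mem[of y] by (auto simp: D_def y_def)
      then show "a \<in> (h \<circ> up) ` D" using s[OF a] \<open>up y = s a\<close> by (auto intro!: image_eqI[of _ _ y])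
    qed
  qed
  have "hom_onto (h \<circ> up) ((product I snd)\<lparr>univ := D\<rparr>) A"
    using h onto by (auto simp: hom_onto_def up_zero up_compl up_oper up_meet D_def)
  moreover have "\<forall>i\<in>I. snd i \<in> K" using B by (auto simp: I_def sB)
  ultimately show ?thesis
    unfolding HSP_def opH_def opS_def opP_def subalgebra_def using D by blast
qed

text \<open>
  The trivial variety is an exception to the failure of the congruence extension property:
  it is normal and unit-preserving, and its star variety is trivial too.
\<close>

lemma trivial_star_variety_has_CEP:
  fixes V :: "'u frame set"
  assumes "\<not> nontrivial V"
  shows "\<not> lacks_CEP (star_variety V)"
proof -
  have triv: "x = y" if "A \<in> star_variety V" "x \<in> univ A" "y \<in> univ A" for A x y
  proof -
    from that(1) obtain I :: "(('u \<Rightarrow> 'u \<times> 'u) \<times> ('u \<times> 'u) frame) set" and B C h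
      where B: "\<forall>i\<in>I. B i \<in> star ` V" and C: "subuniverse C (product I B)"
        and h: "hom_onto h ((product I B)\<lparr>univ := C\<rparr>) A"
      unfolding star_variety_def HSP_def opH_def opS_def opP_def subalgebra_def by blast
    have "u = v" if "u \<in> C" "v \<in> C" for u v
    proof -
      have uv: "u \<in> (\<Pi>\<^sub>E i\<in>I. univ (B i))" "v \<in> (\<Pi>\<^sub>E i\<in>I. univ (B i))"
        using C that by (auto simp: subuniverse_def product_def)
      have "u i = v i" if i: "i \<in> I" for i
      proof -
        obtain E where "E \<in> V" "B i = star E" using B i by blast
        moreover have "u i \<in> univ (B i)" "v i \<in> univ (B i)" using uv i by auto
        ultimately show ?thesis using assms by (auto simp: star_def nontrivial_def)
      qed
      then show ?thesis using uv by (auto intro: PiE_ext)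
    qed
    moreover have "h ` C = univ A" using h by (simp add: hom_onto_def)
    then obtain u v where "u \<in> C" "v \<in> C" "x = h u" "y = h v"
      using \<open>x \<in> univ A\<close> \<open>y \<in> univ A\<close> by blast
    ultimately show ?thesis by blast
  qed
  have "has_CEP A" if A: "A \<in> star_variety V" for A
    unfolding has_CEP_def
  proof (intro allI impI)
    fix B \<Theta> assume *: "subalgebra B A \<and> congruence B \<Theta>"
    then obtain C where C: "subuniverse C A" "B = A\<lparr>univ := C\<rparr>" by (auto simp: subalgebra_def)
    have "univ A = C" using C(1) triv[OF A] by (auto simp: subuniverse_def)
    then have "B = A" using C by simp
    with * show "\<exists>\<Psi>. congruence A \<Psi> \<and> \<Psi> \<inter> (univ B \<times> univ B) = \<Theta>"
      by (intro exI[of _ \<Theta>]) (auto simp: congruence_def equiv_def)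
  qed
  then show ?thesis by (auto simp: lacks_CEP_def)
qed

end

theory Submission
  imports Defs
begin

text \<open>
  In the star of a normal frame the ideal below \<open>c = (1, 0)\<close>, with the operation of the star, is a
  copy of the frame. Suppose the star of \<open>E\<close> is a homomorphic image of a subalgebra of a product of
  stars of frames in \<open>V\<close>. A preimage of \<open>c\<close> may have arbitrary coordinates, but a suitable term
  in it and a second element replaces it by a preimage whose coordinates all lie in
  \<open>{(0, 0), (1, 0), (0, 1)}\<close>; relativizing to it exhibits \<open>E\<close> as a homomorphic image of a subalgebra
  of a product of frames in \<open>V\<close>. The term needs an element \<open>a \<noteq> 0\<close> of \<open>E\<close> with \<open>f(a) \<noteq> 1\<close>, which
  exists after passing from a frame to its square. So \<open>V\<close> can be recovered from its star variety.

  For the congruence extension property, let \<open>a = (1, 0)\<close> in the square \<open>E\<close> of a nontrivial member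
  of \<open>V\<close>. In the star of \<open>E\<close> the operation is the identity on the four-element Boolean subalgebra
  generated by \<open>(1, 0)\<close>, where one can collapse \<open>(1, 0)\<close> to zero. In the whole star this forces
  \<open>(0, a) = f(0, a)\<close> to be congruent to \<open>f(1, a) = 1\<close>, likewise for \<open>-a\<close>, hence \<open>0\<close> to \<open>1\<close>.
\<close>

section \<open>Boolean frames\<close>

text \<open>Later transfer proofs pick these laws by number: 1-4 and 7-10 go to the simplifier,
  while 5, 6 and 11-14 (commutativity, associativity, distributivity) serve as introduction
  rules.\<close>

lemma boolean_frameD:
  assumes "boolean_frame A"
  shows zero_closed: "zero A \<in> univ A"
    and compl_closed: "x \<in> univ A \<Longrightarrow> compl A x \<in> univ A"
    and oper_closed: "x \<in> univ A \<Longrightarrow> oper A x \<in> univ A"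
    and meet_closed: "x \<in> univ A \<Longrightarrow> y \<in> univ A \<Longrightarrow> meet A x y \<in> univ A"
    and meet_comm: "x \<in> univ A \<Longrightarrow> y \<in> univ A \<Longrightarrow> meet A x y = meet A y x"
    and meet_assoc: "x \<in> univ A \<Longrightarrow> y \<in> univ A \<Longrightarrow> z \<in> univ A \<Longrightarrow>
      meet A (meet A x y) z = meet A x (meet A y z)"
    and meet_join_absorb: "x \<in> univ A \<Longrightarrow> y \<in> univ A \<Longrightarrow> meet A x (join A x y) = x"
    and join_meet_absorb: "x \<in> univ A \<Longrightarrow> y \<in> univ A \<Longrightarrow> join A x (meet A x y) = x"
    and meet_compl: "x \<in> univ A \<Longrightarrow> meet A x (compl A x) = zero A"
    and join_compl: "x \<in> univ A \<Longrightarrow> join A x (compl A x) = one A"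
    and join_comm: "x \<in> univ A \<Longrightarrow> y \<in> univ A \<Longrightarrow> join A x y = join A y x"
    and join_assoc: "x \<in> univ A \<Longrightarrow> y \<in> univ A \<Longrightarrow> z \<in> univ A \<Longrightarrow>
      join A (join A x y) z = join A x (join A y z)"
    and meet_join_distrib: "x \<in> univ A \<Longrightarrow> y \<in> univ A \<Longrightarrow> z \<in> univ A \<Longrightarrow>
      meet A x (join A y z) = join A (meet A x y) (meet A x z)"
    and join_meet_distrib: "x \<in> univ A \<Longrightarrow> y \<in> univ A \<Longrightarrow> z \<in> univ A \<Longrightarrow>
      join A x (meet A y z) = meet A (join A x y) (join A x z)"
  using assms unfolding boolean_frame_def by blast+

lemma boolean_frameI:
  assumes "zero A \<in> univ A"
    and "\<And>x. x \<in> univ A \<Longrightarrow> compl A x \<in> univ A"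
    and "\<And>x. x \<in> univ A \<Longrightarrow> oper A x \<in> univ A"
    and "\<And>x y. x \<in> univ A \<Longrightarrow> y \<in> univ A \<Longrightarrow> meet A x y \<in> univ A"
    and "\<And>x y. x \<in> univ A \<Longrightarrow> y \<in> univ A \<Longrightarrow> meet A x y = meet A y x"
    and "\<And>x y z. x \<in> univ A \<Longrightarrow> y \<in> univ A \<Longrightarrow> z \<in> univ A \<Longrightarrow>
      meet A (meet A x y) z = meet A x (meet A y z)"
    and "\<And>x y. x \<in> univ A \<Longrightarrow> y \<in> univ A \<Longrightarrow> meet A x (join A x y) = x"
    and "\<And>x y. x \<in> univ A \<Longrightarrow> y \<in> univ A \<Longrightarrow> join A x (meet A x y) = x"
    and "\<And>x. x \<in> univ A \<Longrightarrow> meet A x (compl A x) = zero A"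
    and "\<And>x. x \<in> univ A \<Longrightarrow> join A x (compl A x) = one A"
    and "\<And>x y. x \<in> univ A \<Longrightarrow> y \<in> univ A \<Longrightarrow> join A x y = join A y x"
    and "\<And>x y z. x \<in> univ A \<Longrightarrow> y \<in> univ A \<Longrightarrow> z \<in> univ A \<Longrightarrow>
      join A (join A x y) z = join A x (join A y z)"
    and "\<And>x y z. x \<in> univ A \<Longrightarrow> y \<in> univ A \<Longrightarrow> z \<in> univ A \<Longrightarrow>
      meet A x (join A y z) = join A (meet A x y) (meet A x z)"
    and "\<And>x y z. x \<in> univ A \<Longrightarrow> y \<in> univ A \<Longrightarrow> z \<in> univ A \<Longrightarrow>
      join A x (meet A y z) = meet A (join A x y) (join A x z)"
  shows "boolean_frame A"
  unfolding boolean_frame_def using assms by (intro conjI ballI) assumption+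

text \<open>All of this comes from absorption and complements. For the double complement:
  \<open>join\<close> is defined by De Morgan, so by idempotence of meet \<open>join A x x\<close>
  is the double complement of \<open>x\<close>, while absorption makes it \<open>x\<close>.\<close>

lemma boolean_frame_arith:
  assumes "boolean_frame A"
  shows one_closed: "one A \<in> univ A"
    and compl_zero: "compl A (zero A) = one A"
    and meet_one: "x \<in> univ A \<Longrightarrow> meet A x (one A) = x"
    and one_meet: "x \<in> univ A \<Longrightarrow> meet A (one A) x = x"
    and meet_idem: "x \<in> univ A \<Longrightarrow> meet A x x = x"
    and meet_zero: "x \<in> univ A \<Longrightarrow> meet A x (zero A) = zero A"
    and zero_meet: "x \<in> univ A \<Longrightarrow> meet A (zero A) x = zero A"
    and compl_compl: "x \<in> univ A \<Longrightarrow> compl A (compl A x) = x"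
    and compl_one: "compl A (one A) = zero A"
proof -
  note D = boolean_frameD[OF assms]
  show one: "one A \<in> univ A" by (simp add: one_def D)
  show "compl A (zero A) = one A" by (simp add: one_def)
  show m1: "meet A x (one A) = x" if "x \<in> univ A" for x
    using D(7)[OF that D(2)[OF that]] by (simp add: D(10) that)
  show "meet A (one A) x = x" if "x \<in> univ A" for x
    using m1[OF that] D(5)[OF that one] by simp
  show idem: "meet A x x = x" if "x \<in> univ A" for x
    using D(7)[OF that D(4)[OF that that]] D(8)[OF that that] by simp
  show m0: "meet A x (zero A) = zero A" if "x \<in> univ A" for x
    using D(6)[OF that that D(2)[OF that]] by (simp add: D(9) idem that)
  show "meet A (zero A) x = zero A" if "x \<in> univ A" for x
    using m0[OF that] D(5)[OF that D(1)] by simp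
  show cc: "compl A (compl A x) = x" if "x \<in> univ A" for x
  proof -
    have "join A x x = x" using D(8)[OF that one] by (simp add: m1 that)
    then show ?thesis by (simp add: join_def idem D(2) that)
  qed
  show "compl A (one A) = zero A" by (simp add: one_def cc D(1))
qed

text \<open>Positions cited repeatedly below: 5 says that \<open>x\<close> and its complement meet
  in 0, 7 that the complement of 0 is 1, 13 is the double complement.\<close>

lemmas boolean_frame_simps =
  zero_closed compl_closed oper_closed meet_closed meet_compl boolean_frame_arith

lemma trivial_of_one_eq_zero:
  assumes "boolean_frame A" "one A = zero A" "x \<in> univ A"
  shows "x = zero A"
  using meet_one[OF assms(1,3)] meet_zero[OF assms(1,3)] assms(2) by simp

section \<open>Stars, products, subalgebras and homomorphic images of Boolean frames\<close>

lemma star_simps: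
  "univ (star A) = univ A \<times> univ A" "zero (star A) = (zero A, zero A)"
  "compl (star A) (a, b) = (compl A a, compl A b)"
  "meet (star A) (a, b) (a', b') = (meet A a a', meet A b b')"
  "oper (star A) (a, b) =
     (if a = zero A \<or> b = zero A then (oper A a, oper A b) else (one A, one A))"
  "one (star A) = (one A, one A)"
  "join (star A) (a, b) (a', b') = (join A a a', join A b b')"
  by (auto simp: star_def one_def join_def)

lemma boolean_frame_star:
  assumes "boolean_frame A"
  shows "boolean_frame (star A)"
proof -
  note D = boolean_frameD[OF assms]
  have "one A \<in> univ A" by (simp add: one_def D)
  then show ?thesis
    by (intro boolean_frameI)
       (auto simp: star_simps D(1-4,7-10) intro: D(5,6,11-14))
qed

lemma boolean_frame_product:
  assumes "\<forall>i\<in>I. boolean_frame (A i)"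
  shows "boolean_frame (product I A)"
proof -
  have j: "join (product I A) x y = (\<lambda>i\<in>I. join (A i) (x i) (y i))" for x y
    by (auto simp: join_def product_def)
  have o: "one (product I A) = (\<lambda>i\<in>I. one (A i))"
    by (auto simp: one_def product_def)
  have ext: "(\<lambda>i\<in>I. g i) = x" if "x \<in> (\<Pi>\<^sub>E i\<in>I. univ (A i))" "\<And>i. i \<in> I \<Longrightarrow> g i = x i" for x g
    using that by (auto simp: fun_eq_iff PiE_def extensional_def)
  have u: "x i \<in> univ (A i)" if "x \<in> (\<Pi>\<^sub>E i\<in>I. univ (A i))" "i \<in> I" for x i
    using that by auto
  have bf: "boolean_frame (A i)" if "i \<in> I" for i using assms that by blast
  show ?thesis
    by (rule boolean_frameI; (unfold j o)?; simp add: product_def cong: restrict_cong)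
       (auto simp: bf u boolean_frameD(1-4,7-10) intro!: ext restrict_ext intro: boolean_frameD(5,6,11-14))
qed

lemma boolean_frame_subuniverse:
  assumes "boolean_frame A" "subuniverse C A"
  shows "boolean_frame (A\<lparr>univ := C\<rparr>)"
proof -
  have [simp]: "join (A\<lparr>univ := C\<rparr>) = join A" "one (A\<lparr>univ := C\<rparr>) = one A"
    by (auto simp: join_def one_def fun_eq_iff)
  note D = boolean_frameD[OF assms(1)]
  have "x \<in> univ A" if "x \<in> C" for x using assms(2) that by (auto simp: subuniverse_def)
  then show ?thesis
    using assms(2)
    by (intro boolean_frameI) (auto simp: subuniverse_def D(7-10) intro: D(5,6,11-14))
qed

lemma boolean_frame_hom_onto:
  assumes "boolean_frame B" "hom_onto h B A"
  shows "boolean_frame A"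
proof -
  have img: "univ A = h ` univ B" using assms(2) by (simp add: hom_onto_def)
  have z: "zero A = h (zero B)" using assms(2) by (simp add: hom_onto_def)
  have c: "compl A (h x) = h (compl B x)" "oper A (h x) = h (oper B x)" if "x \<in> univ B" for x
    using assms(2) that by (simp_all add: hom_onto_def)
  have m: "meet A (h x) (h y) = h (meet B x y)" if "x \<in> univ B" "y \<in> univ B" for x y
    using assms(2) that by (simp add: hom_onto_def)
  note D = boolean_frameD[OF assms(1)]
  have j: "join A (h x) (h y) = h (join B x y)" "join B x y \<in> univ B"
    if "x \<in> univ B" "y \<in> univ B" for x y
    using that by (simp_all add: join_def c m D)
  have o: "one A = h (one B)" by (simp add: one_def z c D)
  show ?thesis
    by (rule boolean_frameI; (unfold img)?; (elim imageE)?; simp add: z c m j o D(1-4,7-10))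
       (auto intro!: arg_cong[of _ _ h] intro: D(5,6,11-14))
qed

section \<open>Closure properties of generated varieties\<close>

text \<open>\<open>HSP\<close> fixes one index type; \<open>HSP_any_index\<close> lets each later
  construction use the index type natural to it.\<close>

lemma HSP_I:
  fixes B :: "'i \<Rightarrow> 'k frame"
  assumes "\<forall>i\<in>I. B i \<in> K" "subuniverse C (product I B)"
    "hom_onto h ((product I B)\<lparr>univ := C\<rparr>) A"
  shows "A \<in> HSP K"
proof -
  have "product I B \<in> opP K" using assms(1) by (auto simp: opP_def)
  then have "(product I B)\<lparr>univ := C\<rparr> \<in> opS (opP K :: ('i \<Rightarrow> 'k) frame set)"
    using assms(2) by (auto simp: opS_def subalgebra_def)
  then have "A \<in> opH (opS (opP K :: ('i \<Rightarrow> 'k) frame set))" using assms(3) by (auto simp: opH_def)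
  then show ?thesis by (rule HSP_any_index)
qed

lemma HSP_E:
  fixes K :: "'k frame set" and A :: "'a frame"
  assumes "A \<in> HSP K"
  obtains I :: "(('a \<Rightarrow> 'k) \<times> 'k frame) set" and B C h
  where "\<forall>i\<in>I. B i \<in> K" "subuniverse C (product I B)"
    "hom_onto h ((product I B)\<lparr>univ := C\<rparr>) A"
  using assms unfolding HSP_def opH_def opS_def opP_def subalgebra_def by blast

lemma hom_onto_comp:
  assumes "hom_onto h B A" "hom_onto g A D"
  shows "hom_onto (g \<circ> h) B D"
proof -
  have img: "univ A = h ` univ B" using assms(1) by (simp add: hom_onto_def)
  show ?thesis
    using assms unfolding hom_onto_def img by (simp add: image_comp)
qed

lemma HSP_hom:
  fixes K :: "'k frame set" and A :: "'a frame"
  assumes "A \<in> HSP K" "hom_onto g A D"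
  shows "D \<in> HSP K"
proof -
  obtain I :: "(('a \<Rightarrow> 'k) \<times> 'k frame) set" and B C h where *: "\<forall>i\<in>I. B i \<in> K" "subuniverse C (product I B)"
    "hom_onto h ((product I B)\<lparr>univ := C\<rparr>) A"
    by (rule HSP_E[OF assms(1)])
  show ?thesis
    by (rule HSP_I[OF *(1,2) hom_onto_comp[OF *(3) assms(2)]])
qed

lemma subuniverse_univ: "boolean_frame A \<Longrightarrow> subuniverse (univ A) A"
  by (auto simp: subuniverse_def boolean_frameD)

lemma HSP_product:
  assumes "\<forall>i\<in>I. A i \<in> K" "\<forall>i\<in>I. boolean_frame (A i)" "hom_onto h (product I A) D"
  shows "D \<in> HSP K"
proof (rule HSP_I)
  show "subuniverse (univ (product I A)) (product I A)"
    using assms(2) by (intro subuniverse_univ boolean_frame_product)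
  show "hom_onto h ((product I A)\<lparr>univ := univ (product I A)\<rparr>) D"
    using assms(3) by simp
qed (rule assms(1))

text \<open>A one-factor product, indexed by \<open>unit\<close>. The map \<open>h\<close> allows
  the result to live in a type other than that of \<open>A\<close>.\<close>

lemma HSP_base:
  assumes "A \<in> K" "boolean_frame A" "hom_onto h A D"
  shows "D \<in> HSP K"
proof (rule HSP_product)
  have "(\<lambda>x. x ()) ` (\<Pi>\<^sub>E i\<in>{()}. univ A) = univ A"
    by (auto simp: image_iff PiE_iff intro!: bexI[of _ "\<lambda>_. _"])
  then have "hom_onto (\<lambda>x. x ()) (product {()} (\<lambda>_. A)) A"
    by (simp add: hom_onto_def product_def)
  from this assms(3)
  show "hom_onto (h \<circ> (\<lambda>x. x ())) (product {()} (\<lambda>_. A)) D" by (rule hom_onto_comp)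
qed (simp_all add: assms)

text \<open>The one-element frame is the image of the empty product, so no member of
  \<open>K\<close> has to be found.\<close>

lemma HSP_trivial:
  fixes K :: "'k frame set"
  assumes "boolean_frame A" "one A = zero A"
  shows "A \<in> HSP K"
proof (rule HSP_product)
  have z: "zero A \<in> univ A" by (rule zero_closed[OF assms(1)])
  have triv: "x = zero A" if "x \<in> univ A" for x
    by (rule trivial_of_one_eq_zero[OF assms that])
  have "univ A = {zero A}" using z triv by blast
  moreover have "compl A (zero A) = zero A" by (rule triv[OF compl_closed[OF assms(1) z]])
  moreover have "oper A (zero A) = zero A" by (rule triv[OF oper_closed[OF assms(1) z]])
  moreover have "meet A (zero A) (zero A) = zero A"
    by (rule triv[OF meet_closed[OF assms(1) z z]])
  ultimately show "hom_onto (\<lambda>_. zero A) (product ({} :: unit set) (\<lambda>_. undefined :: 'k frame)) A"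
    by (simp add: hom_onto_def product_def)
qed simp_all

lemma boolean_frame_HSP:
  fixes K :: "'k frame set" and A :: "'a frame"
  assumes "\<forall>B\<in>K. boolean_frame B" "A \<in> HSP K"
  shows "boolean_frame A"
proof -
  obtain I :: "(('a \<Rightarrow> 'k) \<times> 'k frame) set" and B C h where *: "\<forall>i\<in>I. B i \<in> K" "subuniverse C (product I B)"
    "hom_onto h ((product I B)\<lparr>univ := C\<rparr>) A"
    by (rule HSP_E[OF assms(2)])
  show ?thesis
    by (rule boolean_frame_hom_onto[OF boolean_frame_subuniverse[OF boolean_frame_product *(2)] *(3)])
       (use *(1) assms(1) in blast)
qed

lemma hom_onto_id: "hom_onto id A A"
  by (simp add: hom_onto_def)

text \<open>A product of quotients of subalgebras of products is flattened to one product over the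
  disjoint union \<open>L\<close> of the index sets. \<open>row\<close> cuts out the block over
  \<open>i\<close>, \<open>G\<close> applies the inner homomorphisms block by block, and
  \<open>D\<close> keeps the elements whose blocks lie in the inner subalgebras and whose image lies
  in \<open>C\<close>.\<close>

lemma HSP_HSP_subset:
  fixes K :: "'k frame set"
  shows "HSP (HSP K :: 'b frame set) \<subseteq> (HSP K :: 'a frame set)"
proof
  fix A :: "'a frame" assume "A \<in> HSP (HSP K :: 'b frame set)"
  then obtain I :: "(('a \<Rightarrow> 'b) \<times> 'b frame) set" and W :: "_ \<Rightarrow> 'b frame" and C h
    where W: "\<forall>i\<in>I. W i \<in> HSP K" and C: "subuniverse C (product I W)"
      and h: "hom_onto h ((product I W)\<lparr>univ := C\<rparr>) A"
    by (rule HSP_E)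
  have "\<forall>i\<in>I. \<exists>J :: (('b \<Rightarrow> 'k) \<times> 'k frame) set. \<exists>B C h. (\<forall>j\<in>J. B j \<in> K) \<and>
      subuniverse C (product J B) \<and> hom_onto h ((product J B)\<lparr>univ := C\<rparr>) (W i)"
  proof
    fix i assume "i \<in> I"
    with W have "W i \<in> HSP K" by blast
    then show "\<exists>J :: (('b \<Rightarrow> 'k) \<times> 'k frame) set. \<exists>B C h. (\<forall>j\<in>J. B j \<in> K) \<and>
      subuniverse C (product J B) \<and> hom_onto h ((product J B)\<lparr>univ := C\<rparr>) (W i)"
      by (rule HSP_E) blast
  qed
  then obtain J :: "_ \<Rightarrow> (('b \<Rightarrow> 'k) \<times> 'k frame) set" and B E g where
    B: "\<And>i j. i \<in> I \<Longrightarrow> j \<in> J i \<Longrightarrow> B i j \<in> K"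
    and E: "\<And>i. i \<in> I \<Longrightarrow> subuniverse (E i) (product (J i) (B i))"
    and g: "\<And>i. i \<in> I \<Longrightarrow> hom_onto (g i) ((product (J i) (B i))\<lparr>univ := E i\<rparr>) (W i)"
    by metis
  define L where "L = Sigma I J"
  define F where "F = (\<lambda>(i, j). B i j)"
  define row where "row y i = (\<lambda>j\<in>J i. y (i, j))" for y :: "_ \<times> _ \<Rightarrow> 'k" and i
  define G where "G y = (\<lambda>i\<in>I. g i (row y i))" for y
  define D where "D = {y \<in> extensional L. (\<forall>i\<in>I. row y i \<in> E i) \<and> G y \<in> C}"
  have img: "g i ` E i = univ (W i)" if "i \<in> I" for i
    using g[OF that] by (simp add: hom_onto_def)
  have row: "row (zero (product L F)) i = zero (product (J i) (B i))"
    "row (compl (product L F) y) i = compl (product (J i) (B i)) (row y i)"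
    "row (oper (product L F) y) i = oper (product (J i) (B i)) (row y i)"
    "row (meet (product L F) y z) i = meet (product (J i) (B i)) (row y i) (row z i)"
    if "i \<in> I" for i y z
    using that by (auto simp: row_def product_def L_def F_def fun_eq_iff)
  have G: "G (zero (product L F)) = zero (product I W)"
    "(\<forall>i\<in>I. row y i \<in> E i) \<Longrightarrow> G (compl (product L F) y) = compl (product I W) (G y)"
    "(\<forall>i\<in>I. row y i \<in> E i) \<Longrightarrow> G (oper (product L F) y) = oper (product I W) (G y)"
    "(\<forall>i\<in>I. row y i \<in> E i) \<Longrightarrow> (\<forall>i\<in>I. row z i \<in> E i) \<Longrightarrow>
      G (meet (product L F) y z) = meet (product I W) (G y) (G z)" for y z
    using g by (auto simp: G_def row hom_onto_def product_def[of I W] fun_eq_iff)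
  have Eclosed: "zero (product (J i) (B i)) \<in> E i"
    "x \<in> E i \<Longrightarrow> compl (product (J i) (B i)) x \<in> E i"
    "x \<in> E i \<Longrightarrow> oper (product (J i) (B i)) x \<in> E i"
    "x \<in> E i \<Longrightarrow> y \<in> E i \<Longrightarrow> meet (product (J i) (B i)) x y \<in> E i"
    "x \<in> E i \<Longrightarrow> x \<in> univ (product (J i) (B i))"
    if "i \<in> I" for i x y
    using E[OF that] by (auto simp: subuniverse_def)
  have Cclosed: "zero (product I W) \<in> C"
    "x \<in> C \<Longrightarrow> compl (product I W) x \<in> C"
    "x \<in> C \<Longrightarrow> oper (product I W) x \<in> C"
    "x \<in> C \<Longrightarrow> y \<in> C \<Longrightarrow> meet (product I W) x y \<in> C"
    "x \<in> C \<Longrightarrow> x \<in> univ (product I W)" for x y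
    using C by (auto simp: subuniverse_def)
  have exten: "zero (product L F) \<in> extensional L" "compl (product L F) y \<in> extensional L"
    "oper (product L F) y \<in> extensional L" "meet (product L F) y z \<in> extensional L" for y z
    by (auto simp: product_def)
  have Dsub: "D \<subseteq> univ (product L F)"
  proof
    fix y assume y: "y \<in> D"
    have "y (i, j) \<in> univ (B i j)" if "i \<in> I" "j \<in> J i" for i j
    proof -
      have "row y i \<in> univ (product (J i) (B i))"
        using y that by (auto simp: D_def intro: Eclosed)
      then have "row y i j \<in> univ (B i j)" using that by (auto simp: product_def)
      then show ?thesis using that by (simp add: row_def)
    qed
    then show "y \<in> univ (product L F)"
      using y by (auto simp: D_def product_def L_def F_def PiE_iff)
  qed
  have D: "subuniverse D (product L F)"
    unfolding subuniverse_def using Dsub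
    by (auto simp: D_def exten row G Eclosed Cclosed)
  have surjG: "G ` D = C"
  proof
    show "G ` D \<subseteq> C" by (auto simp: D_def)
    show "C \<subseteq> G ` D"
    proof
      fix z assume z: "z \<in> C"
      \<comment> \<open>A preimage of \<open>z\<close> under \<open>G\<close>: choose
        \<open>e i\<close> in \<open>E i\<close> above each coordinate of \<open>z\<close> and glue
        these along \<open>L\<close>.\<close>
      have zu: "z i \<in> g i ` E i" if "i \<in> I" for i
        using Cclosed(5)[OF z] that by (auto simp: product_def img)
      then have "\<forall>i\<in>I. \<exists>e. e \<in> E i \<and> g i e = z i" by (metis imageE)
      then obtain e where e: "\<And>i. i \<in> I \<Longrightarrow> e i \<in> E i \<and> g i (e i) = z i" by metis
      define y where "y = (\<lambda>(i, j)\<in>L. e i j)"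
      have ry: "row y i = e i" if "i \<in> I" for i
      proof -
        have "e i \<in> extensional (J i)"
          using Eclosed(5)[OF that] e[OF that] by (auto simp: product_def PiE_iff)
        then show ?thesis
          using that by (auto simp: row_def y_def L_def fun_eq_iff extensional_def)
      qed
      have "z \<in> extensional I" using Cclosed(5)[OF z] by (auto simp: product_def PiE_iff)
      then have "G y = z"
        using e by (auto simp: G_def ry fun_eq_iff extensional_def)
      moreover from this have "y \<in> D"
        using e z by (auto simp: D_def ry) (auto simp: y_def)
      ultimately show "z \<in> G ` D" by blast
    qed
  qed
  have "hom_onto G ((product L F)\<lparr>univ := D\<rparr>) ((product I W)\<lparr>univ := C\<rparr>)"
    using surjG by (auto simp: hom_onto_def D_def G)
  from hom_onto_comp[OF this h]
  have "hom_onto (h \<circ> G) ((product L F)\<lparr>univ := D\<rparr>) A" .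
  moreover have "\<forall>l\<in>L. F l \<in> K" using B by (auto simp: L_def F_def)
  ultimately show "A \<in> HSP K" using D HSP_I by blast
qed

lemma variety_HSP:
  fixes K :: "'k frame set"
  assumes "\<forall>B\<in>K. boolean_frame B"
  shows "variety (HSP K :: 'a frame set)"
proof -
  have bf: "boolean_frame A" if "A \<in> HSP K" for A :: "'a frame"
    using assms that by (rule boolean_frame_HSP)
  then have "(HSP K :: 'a frame set) \<subseteq> HSP (HSP K :: 'a frame set)"
    using HSP_base[OF _ _ hom_onto_id] by blast
  moreover have "HSP (HSP K :: 'a frame set) \<subseteq> (HSP K :: 'a frame set)"
    by (rule HSP_HSP_subset)
  ultimately show ?thesis using bf by (simp add: variety_def subset_antisym)
qed

section \<open>Transport and squares\<close>

text \<open>Varieties are represented only by members with elements in \<open>'u\<close>. Squares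
  and stars have other element types and are copied back along an injection.\<close>

definition transport :: "('a \<Rightarrow> 'b) \<Rightarrow> 'a frame \<Rightarrow> 'b frame" where
  "transport \<phi> A = \<lparr>univ = \<phi> ` univ A,
     meet = (\<lambda>x y. \<phi> (meet A (inv \<phi> x) (inv \<phi> y))),
     compl = (\<lambda>x. \<phi> (compl A (inv \<phi> x))),
     zero = \<phi> (zero A),
     oper = (\<lambda>x. \<phi> (oper A (inv \<phi> x)))\<rparr>"

lemma transport_hom:
  assumes "inj \<phi>"
  shows "hom_onto \<phi> A (transport \<phi> A)" "hom_onto (inv \<phi>) (transport \<phi> A) A"
  using assms by (auto simp: hom_onto_def transport_def image_comp)

lemma hom_ontoD:
  assumes "hom_onto h B A"
  shows "h (zero B) = zero A"
    and "x \<in> univ B \<Longrightarrow> h (compl B x) = compl A (h x)"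
    and "x \<in> univ B \<Longrightarrow> h (oper B x) = oper A (h x)"
    and "x \<in> univ B \<Longrightarrow> y \<in> univ B \<Longrightarrow> h (meet B x y) = meet A (h x) (h y)"
    and "x \<in> univ B \<Longrightarrow> h x \<in> univ A"
  using assms by (auto simp: hom_onto_def)

text \<open>Cardinal arithmetic: an infinite set is equinumerous with its square.\<close>

lemma inj_pairing_exists:
  assumes "infinite (UNIV :: 'u set)"
  obtains \<phi> :: "'u \<times> 'u \<Rightarrow> 'u" where "inj \<phi>"
proof -
  have "(card_of (UNIV \<times> UNIV :: ('u \<times> 'u) set), card_of (UNIV :: 'u set)) \<in> ordIso"
    using card_of_Times_same_infinite[OF assms] .
  then obtain f :: "'u \<times> 'u \<Rightarrow> 'u" where "bij_betw f (UNIV \<times> UNIV) UNIV"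
    using card_of_ordIso by blast
  then show ?thesis using that by (auto simp: bij_betw_def)
qed

text \<open>\<open>E\<close> is a copy of the square of \<open>A\<close>, \<open>p\<close> a
  projection and \<open>a\<close> the copy of (1, 0), which the operation fixes because
  \<open>A\<close> is normal and unit-preserving.\<close>

lemma variety_contains_square:
  fixes A :: "'u frame"
  assumes inf: "infinite (UNIV :: 'u set)" and V: "variety V"
    and nu: "\<forall>A\<in>V. normal A \<and> unit_preserving A"
    and A: "A \<in> V" "one A \<noteq> zero A"
  obtains E p a where "E \<in> V" "hom_onto p E A" "a \<in> univ E" "a \<noteq> zero E" "a \<noteq> one E"
    "oper E a = a" "oper E (compl E a) = compl E a"
proof -
  obtain \<phi> :: "'u \<times> 'u \<Rightarrow> 'u" where \<phi>: "inj \<phi>" using inj_pairing_exists[OF inf] .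
  \<comment> \<open>Elements of \<open>product\<close> are functions, so the square is indexed by
    \<open>bool\<close> and a function is coded by the pair of its two values.\<close>
  define \<psi> where "\<psi> g = \<phi> (g True, g False)" for g
  have \<psi>: "inj \<psi>"
  proof (rule injI)
    fix g k :: "bool \<Rightarrow> 'u" assume "\<psi> g = \<psi> k"
    then have "(g True, g False) = (k True, k False)" using \<phi> by (auto simp: \<psi>_def dest: injD)
    then show "g = k" by (auto simp: fun_eq_iff all_bool_eq)
  qed
  have bf: "boolean_frame A" and n: "oper A (zero A) = zero A" "oper A (one A) = one A"
    using V nu A by (auto simp: variety_def normal_def unit_preserving_def)
  define P where "P = product (UNIV :: bool set) (\<lambda>_. A)"
  define E where "E = transport \<psi> P"
  note hom = transport_hom(1)[OF \<psi>, of P, folded E_def]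
  have E: "E \<in> V"
    using HSP_product[OF _ _ hom[unfolded P_def], of V] bf A V by (simp add: variety_def)
  have "(\<lambda>x. x True) ` univ P = univ A"
    by (auto simp: P_def product_def image_iff PiE_iff intro!: bexI[of _ "\<lambda>_. _"])
  then have "hom_onto (\<lambda>x. x True) P A"
    by (simp add: hom_onto_def P_def product_def)
  from hom_onto_comp[OF transport_hom(2)[OF \<psi>] this]
  have p: "hom_onto ((\<lambda>x. x True) \<circ> inv \<psi>) E A" unfolding E_def .
  define b where "b = (\<lambda>t. if t then one A else zero A)"
  have b: "b \<in> univ P" "compl P b \<in> univ P"
    using bf by (auto simp: b_def P_def product_def boolean_frame_simps)
  have P: "b \<noteq> zero P" "b \<noteq> compl P (zero P)" "oper P b = b" "oper P (compl P b) = compl P b"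
    using A(2) n by (auto simp: b_def P_def product_def fun_eq_iff boolean_frame_simps[OF bf])
  have z: "zero P \<in> univ P" using bf by (simp add: P_def product_def boolean_frame_simps)
  note H = hom_ontoD[OF hom]
  have "\<psi> b \<noteq> zero E" "\<psi> b \<noteq> one E"
    using P(1,2) \<psi> by (simp_all add: one_def H(1,2)[symmetric] z inj_eq)
  moreover have "oper E (\<psi> b) = \<psi> b" "oper E (compl E (\<psi> b)) = compl E (\<psi> b)"
    by (simp_all add: H(2,3)[symmetric] b P)
  ultimately show ?thesis using that E p H(5)[OF b(1)] by blast
qed

section \<open>Recovering a variety from its star variety\<close>

text \<open>
  In a star, \<open>corner\<close> fixes \<open>(1, 0)\<close> and moves every element into \<open>{0, 1} \<times> {0, 1}\<close>. For \<open>c\<close> in this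
  set, \<open>mask\<close> is \<open>f(q \<squnion> -c) \<sqinter> c\<close> with \<open>q = c \<sqinter> f(x) \<sqinter> -f(x \<sqinter> c)\<close>: it always sends \<open>c = (1, 1)\<close> to
  \<open>0\<close>, because then \<open>q = 0\<close>, and it keeps \<open>c = (1, 0)\<close> if \<open>x = (a, a)\<close> with \<open>a \<noteq> 0\<close> and \<open>f(a) \<noteq> 1\<close>.
  The second argument is indispensable: no unary term separates \<open>(1, 0)\<close> from \<open>(1, 1)\<close>, since the
  operation is the identity on \<open>{0, 1} \<times> {0, 1}\<close>.
\<close>

definition corner :: "'a frame \<Rightarrow> 'a \<Rightarrow> 'a" where
  "corner S c = oper S (compl S (oper S (compl S c)))"

definition mask :: "'a frame \<Rightarrow> 'a \<Rightarrow> 'a \<Rightarrow> 'a" where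
  "mask S c x = meet S (oper S (compl S (meet S (compl S
     (meet S c (meet S (oper S x) (compl S (oper S (meet S x c)))))) c))) c"

text \<open>If neither coordinate of \<open>c\<close> is 1, the inner operation yields (1, 1) and
  the result is (0, 0). If one coordinate is 1, it stays 1, and the other becomes 0 or 1 according
  to which clause of the star operation applies.\<close>

lemma corner_star:
  assumes "boolean_frame B" "normal B" "unit_preserving B" "c \<in> univ (star B)"
  shows "corner (star B) c \<in> {zero B, one B} \<times> {zero B, one B}"
proof -
  obtain u v where c: "c = (u, v)" "u \<in> univ B" "v \<in> univ B"
    using assms(4) by (auto simp: star_simps)
  note s = boolean_frame_simps[OF assms(1)]
  have n: "oper B (zero B) = zero B" "oper B (one B) = one B"
    using assms(2,3) by (auto simp: normal_def unit_preserving_def)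
  have one: "w = one B" if "compl B w = zero B" "w \<in> univ B" for w
    using s(13)[OF that(2)] that(1) s(7) by simp
  \<comment> \<open>In a one-element frame 1 equals 0, so the first clause of the star operation
    applies even to arguments with coordinate 1.\<close>
  have triv: "w = zero B" if "one B = zero B" "w \<in> univ B" for w
    using trivial_of_one_eq_zero[OF assms(1)] that by blast
  consider "compl B u \<noteq> zero B" "compl B v \<noteq> zero B" | "u = one B" | "v = one B"
    using one c by blast
  then show ?thesis
  proof cases
    case 1
    then show ?thesis by (simp add: c corner_def star_simps s n)
  next
    case 2
    then show ?thesis
      using triv[of "compl B (oper B (compl B v))"] c(3)
      by (simp add: c(1) corner_def star_simps s n)
  next
    case 3
    then show ?thesis
      using triv[of "compl B (oper B (compl B u))"] c(2)
      by (simp add: c(1) corner_def star_simps s n)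
  qed
qed

text \<open>For \<open>c\<close> = (1, 0) the argument of the outer operation has the form (w, 1).
  It is sent to (0, 1) if w = 0 and to (1, 1) otherwise, and meeting with \<open>c\<close> leaves
  (0, 0) or (1, 0). The case (0, 1) is symmetric.\<close>

lemma mask_star:
  assumes "boolean_frame B" "normal B" "unit_preserving B" "x \<in> univ (star B)"
    and "c \<in> {zero B, one B} \<times> {zero B, one B}"
  shows "mask (star B) c x \<in> {(zero B, zero B), (one B, zero B), (zero B, one B)}"
proof -
  obtain u v where x: "x = (u, v)" "u \<in> univ B" "v \<in> univ B"
    using assms(4) by (auto simp: star_simps)
  note s = boolean_frame_simps[OF assms(1)]
  have n: "oper B (zero B) = zero B" "oper B (one B) = one B"
    using assms(2,3) by (auto simp: normal_def unit_preserving_def)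
  show ?thesis
  proof (cases "one B = zero B")
    case True
    then have "w = zero B" if "w \<in> univ B" for w
      using trivial_of_one_eq_zero[OF assms(1)] that by blast
    moreover have "c \<in> univ (star B)" using assms(5) s by (auto simp: star_simps)
    then have "mask (star B) c x \<in> univ (star B)"
      using boolean_frame_simps[OF boolean_frame_star[OF assms(1)]] assms(4)
      by (simp add: mask_def)
    ultimately show ?thesis by (auto simp: star_simps)
  next
    case False
    show ?thesis
      using assms(5) False unfolding x(1) mask_def
      by (auto simp: star_simps s x n split: if_splits)
  qed
qed

lemma hom_onto_corner:
  assumes "hom_onto h S T" "subuniverse (univ S) S" "c \<in> univ S"
  shows "h (corner S c) = corner T (h c)" "corner S c \<in> univ S"
  using assms by (simp_all add: corner_def hom_onto_def subuniverse_def)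

lemma hom_onto_mask:
  assumes "hom_onto h S T" "subuniverse (univ S) S" "c \<in> univ S" "x \<in> univ S"
  shows "h (mask S c x) = mask T (h c) (h x)" "mask S c x \<in> univ S"
  using assms by (simp_all add: mask_def hom_onto_def subuniverse_def)

text \<open>The masked preimage \<open>m\<close> of (1, 0) selects one of the two coordinates in
  each factor, or none. \<open>\<pi>\<close> reads off the selected coordinates, and the first
  coordinate of \<open>h\<close> factors through \<open>\<pi>\<close>.\<close>

lemma star_reflects_HSP:
  fixes V :: "'v frame set" and E :: "'e frame"
  assumes V: "\<forall>B\<in>V. boolean_frame B \<and> normal B \<and> unit_preserving B"
    and E: "boolean_frame E" "normal E" "unit_preserving E"
    and a: "a \<in> univ E" "a \<noteq> zero E" "oper E a \<noteq> one E"
    and mem: "star E \<in> HSP (star ` V)"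
  shows "E \<in> HSP V"
proof -
  from mem obtain I :: "(('e \<times> 'e \<Rightarrow> 'v \<times> 'v) \<times> ('v \<times> 'v) frame) set" and S C h
    where S: "\<forall>i\<in>I. S i \<in> star ` V" and C0: "subuniverse C (product I S)"
      and h0: "hom_onto h ((product I S)\<lparr>univ := C\<rparr>) (star E)"
    by (rule HSP_E)
  have "\<forall>i\<in>I. \<exists>b. b \<in> V \<and> S i = star b" using S by blast
  from bchoice[OF this] obtain B where B: "\<forall>i\<in>I. B i \<in> V \<and> S i = star (B i)" ..
  define P where "P = product I (\<lambda>i. star (B i))"
  have "product I S = P" using B by (auto simp: P_def product_def fun_eq_iff PiE_iff)
  note C = C0[unfolded this] and h = h0[unfolded this]
  have Bf: "boolean_frame (B i)" "normal (B i)" "unit_preserving (B i)" if "i \<in> I" for i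
    using B V that by auto
  have Cu: "x i \<in> univ (B i) \<times> univ (B i)" if "x \<in> C" "i \<in> I" for x i
  proof -
    have "x \<in> univ P" using C that by (auto simp: subuniverse_def)
    then show ?thesis using that by (auto simp: P_def product_def star_simps)
  qed
  define Q where "Q = P\<lparr>univ := C\<rparr>"
  note hQ = h[folded Q_def]
  have Q: "univ Q = C" "subuniverse (univ Q) Q"
    using C by (auto simp: Q_def subuniverse_def)
  have img: "h ` C = univ E \<times> univ E" using hQ Q by (auto simp: hom_onto_def star_simps)
  note e = boolean_frame_simps[OF E(1)]
  have en: "oper E (zero E) = zero E" "oper E (one E) = one E"
    using E(2,3) by (auto simp: normal_def unit_preserving_def)
  have "(one E, zero E) \<in> h ` C" "(a, a) \<in> h ` C" using a e by (auto simp: img)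
  then obtain c x where c: "c \<in> C" "h c = (one E, zero E)" and x: "x \<in> C" "h x = (a, a)"
    by (metis imageE)
  define m where "m = mask Q (corner Q c) x"
  have mC: "m \<in> C"
    using hom_onto_mask(2)[OF hQ Q(2)] hom_onto_corner(2)[OF hQ Q(2)] c x Q(1) by (simp add: m_def)
  have "oper E a \<in> univ E" using a e by simp
  then have "compl E (oper E a) \<noteq> zero E"
    using a(3) e(13)[of "oper E a"] e(7) by auto
  moreover have "one E \<noteq> zero E" using trivial_of_one_eq_zero[OF E(1) _ a(1)] a(2) by blast
  \<comment> \<open>\<open>corner\<close> fixes (1, 0). Since \<open>a\<close> is not 0, the
    operation sends (a, a) to (1, 1), so the outer operation of \<open>mask\<close> is applied to
    (-f(a), 1); as -f(a) is not 0, this gives (1, 1).\<close>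
  ultimately have hm: "h m = (one E, zero E)"
    using hom_onto_mask(1)[OF hQ Q(2)] hom_onto_corner[OF hQ Q(2)] c x Q(1) a
    by (simp add: m_def corner_def mask_def star_simps e en)
  have mi: "m i \<in> {(zero (B i), zero (B i)), (one (B i), zero (B i)), (zero (B i), one (B i))}"
    if i: "i \<in> I" for i
  proof -
    have "m i = mask (star (B i)) (corner (star (B i)) (c i)) (x i)"
      using i by (simp add: m_def mask_def corner_def Q_def P_def product_def)
    then show ?thesis
      using mask_star[OF Bf[OF i] _ corner_star[OF Bf[OF i]]] Cu[OF c(1) i] Cu[OF x(1) i]
      by (simp add: star_simps)
  qed
  define J where "J = {i \<in> I. m i \<noteq> (zero (B i), zero (B i))}"
  define \<sigma> where "\<sigma> i = (if m i = (one (B i), zero (B i)) then fst else snd :: 'v \<times> 'v \<Rightarrow> 'v)" for i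
  define \<pi> where "\<pi> y = (\<lambda>i\<in>J. \<sigma> i (y i))" for y :: "_ \<Rightarrow> 'v \<times> 'v"
  have \<sigma>: "\<sigma> i (zero (star (B i))) = zero (B i)"
    "\<sigma> i (compl (star (B i)) p) = compl (B i) (\<sigma> i p)"
    "\<sigma> i (meet (star (B i)) p q) = meet (B i) (\<sigma> i p) (\<sigma> i q)" for i p q
    by (cases p; cases q; auto simp: \<sigma>_def star_simps)+
  \<comment> \<open>Meeting with \<open>m i\<close> makes the unselected coordinate 0, so the star
    operation acts coordinatewise.\<close>
  have \<sigma>_oper: "\<sigma> i (oper (star (B i)) (meet (star (B i)) p (m i))) = oper (B i) (\<sigma> i p)"
    if i: "i \<in> J" and p: "p \<in> univ (B i) \<times> univ (B i)" for i p
  proof -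
    have iI: "i \<in> I" using i by (simp add: J_def)
    show ?thesis
      using mi[OF iI] i p Bf[OF iI] unfolding J_def
      by (cases p) (auto simp: \<sigma>_def star_simps boolean_frame_simps normal_def)
  qed
  have Cc: "zero P \<in> C" "\<And>x. x \<in> C \<Longrightarrow> compl P x \<in> C" "\<And>x. x \<in> C \<Longrightarrow> oper P x \<in> C"
    "\<And>x y. x \<in> C \<Longrightarrow> y \<in> C \<Longrightarrow> meet P x y \<in> C"
    using C by (auto simp: subuniverse_def)
  have JI: "J \<subseteq> I" by (auto simp: J_def)
  let ?R = "product J B"
  have \<pi>: "\<pi> (zero P) = zero ?R" "\<pi> (compl P y) = compl ?R (\<pi> y)"
    "\<pi> (meet P y z) = meet ?R (\<pi> y) (\<pi> z)" for y z
    using JI by (auto simp: \<pi>_def P_def product_def \<sigma> fun_eq_iff)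
  have \<pi>_oper: "\<pi> (oper P (meet P y m)) = oper ?R (\<pi> y)" if "y \<in> C" for y
    using JI Cu[OF that] by (auto simp: \<pi>_def P_def product_def fun_eq_iff \<sigma>_oper subset_iff)
  have sub: "subuniverse (\<pi> ` C) ?R"
    unfolding subuniverse_def
  proof (intro conjI ballI)
    show "\<pi> ` C \<subseteq> univ ?R"
    proof (intro subsetI, elim imageE)
      fix z y assume "z = \<pi> y" "y \<in> C"
      then show "z \<in> univ ?R"
        using Cu[of y] JI by (auto simp: \<pi>_def product_def \<sigma>_def PiE_iff mem_Times_iff subset_iff)
    qed
    show "zero ?R \<in> \<pi> ` C" using Cc(1) by (simp flip: \<pi>(1))
    show "compl ?R z \<in> \<pi> ` C" if "z \<in> \<pi> ` C" for z
      using that Cc(2) by (auto simp flip: \<pi>(2))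
    \<comment> \<open>The operation of the product is represented in \<open>C\<close> by the
      relativized one, f(y meet m), so closure uses that \<open>m\<close> lies in
      \<open>C\<close>.\<close>
    show "oper ?R z \<in> \<pi> ` C" if "z \<in> \<pi> ` C" for z
      using that Cc(3,4) mC by (auto simp flip: \<pi>_oper)
    show "meet ?R z w \<in> \<pi> ` C" if "z \<in> \<pi> ` C" "w \<in> \<pi> ` C" for z w
      using that Cc(4) by (auto simp flip: \<pi>(3))
  qed
  note H = hom_ontoD[OF hQ, unfolded Q(1)]
  have Hs: "zero Q = zero P" "compl Q = compl P" "oper Q = oper P" "meet Q = meet P"
    by (simp_all add: Q_def)
  have huniv: "fst (h y) \<in> univ E" "snd (h y) \<in> univ E" if "y \<in> C" for y
    using H(5)[OF that] by (auto simp: star_simps)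
  have hmeet: "h (meet P y m) = (fst (h y), zero E)" if "y \<in> C" for y
    using H(4)[OF that mC] huniv[OF that] by (cases "h y") (simp add: Hs hm star_simps e)
  \<comment> \<open>By \<open>hmeet\<close> it suffices that \<open>\<pi> y\<close> determines the
    meet of \<open>y\<close> with \<open>m\<close>: at each index only the selected coordinate
    survives, and the rest is 0.\<close>
  have eq: "fst (h y) = fst (h z)" if yz: "y \<in> C" "z \<in> C" "\<pi> y = \<pi> z" for y z
  proof -
    have "meet P y m i = meet P z m i" for i
    proof (cases "i \<in> I")
      case True
      have s: "i \<in> J \<Longrightarrow> \<sigma> i (y i) = \<sigma> i (z i)"
        using fun_cong[OF yz(3), of i] by (simp add: \<pi>_def)
      note b = boolean_frame_simps[OF Bf(1)[OF True]]
      obtain u v where yi: "y i = (u, v)" "u \<in> univ (B i)" "v \<in> univ (B i)"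
        using Cu[OF yz(1) True] by auto
      obtain u' v' where zi: "z i = (u', v')" "u' \<in> univ (B i)" "v' \<in> univ (B i)"
        using Cu[OF yz(2) True] by auto
      have "meet (star (B i)) (y i) (m i) = meet (star (B i)) (z i) (m i)"
      proof (cases "i \<in> J")
        case False
        then have "m i = (zero (B i), zero (B i))" using True by (simp add: J_def)
        then show ?thesis by (simp add: yi zi star_simps b)
      next
        case J: True
        show ?thesis
        proof (cases "m i = (one (B i), zero (B i))")
          case True
          then show ?thesis using s[OF J] by (simp add: \<sigma>_def yi zi star_simps b)
        next
          case False
          then have "m i = (zero (B i), one (B i))" using mi[OF True] J by (auto simp: J_def)
          then show ?thesis using False s[OF J] by (simp add: \<sigma>_def yi zi star_simps b split: if_splits)
        qed
      qed
      then show ?thesis using True by (simp add: P_def product_def)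
    qed (simp add: P_def product_def)
    then have "meet P y m = meet P z m" by (rule ext)
    then show ?thesis using hmeet[OF yz(1)] hmeet[OF yz(2)] by simp
  qed
  \<comment> \<open>Any preimage under \<open>\<pi>\<close> will do; \<open>eq\<close> makes the
    value independent of the choice.\<close>
  define k where "k z = fst (h (SOME y. y \<in> C \<and> \<pi> y = z))" for z
  have k: "k (\<pi> y) = fst (h y)" if "y \<in> C" for y
  proof -
    have "\<exists>w. w \<in> C \<and> \<pi> w = \<pi> y" using that by blast
    from someI_ex[OF this] show ?thesis unfolding k_def using eq that by blast
  qed
  have fststar: "fst (compl (star E) p) = compl E (fst p)"
    "fst (meet (star E) p q) = meet E (fst p) (fst q)" for p q
    by (cases p; cases q; simp add: star_simps)+
  have "k ` \<pi> ` C = fst ` h ` C" using k by (force simp: image_iff)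
  also have "\<dots> = univ E" using e(1) by (force simp: img image_iff)
  finally have "k ` \<pi> ` C = univ E" .
  moreover have "k (zero ?R) = zero E"
    using k[OF Cc(1)] H(1) by (simp add: \<pi> Hs star_simps)
  moreover have "k (compl ?R (\<pi> y)) = compl E (k (\<pi> y))" if "y \<in> C" for y
    using k[OF Cc(2)[OF that]] H(2)[OF that] k[OF that] by (simp add: \<pi> Hs fststar)
  moreover have "k (oper ?R (\<pi> y)) = oper E (k (\<pi> y))" if "y \<in> C" for y
    using k[OF Cc(3)[OF Cc(4)[OF that mC]]] H(3)[OF Cc(4)[OF that mC]] k[OF that] hmeet[OF that]
    by (simp add: \<pi>_oper that Hs star_simps)
  moreover have "k (meet ?R (\<pi> y) (\<pi> z)) = meet E (k (\<pi> y)) (k (\<pi> z))"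
    if "y \<in> C" "z \<in> C" for y z
    using k[OF Cc(4)[OF that]] H(4)[OF that] k[OF that(1)] k[OF that(2)]
    by (simp add: \<pi> Hs fststar)
  ultimately have "hom_onto k (?R\<lparr>univ := \<pi> ` C\<rparr>) E"
    by (auto simp: hom_onto_def)
  then show ?thesis using HSP_I[OF _ sub, of V] B JI by blast
qed

lemma star_copy_in_star_variety:
  fixes V :: "'u frame set"
  assumes "inj \<phi>" "boolean_frame E" "E \<in> V"
  shows "transport \<phi> (star E) \<in> star_variety V"
  unfolding star_variety_def
  by (rule HSP_base[OF _ boolean_frame_star transport_hom(1)]) (use assms in auto)

text \<open>A nontrivial \<open>A\<close> is an image of its square \<open>E\<close>, which has the
  element required by \<open>star_reflects_HSP\<close>: there f(a) = a differs from 1. One-element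
  frames have no such element and are treated apart.\<close>

lemma star_variety_subset_reflects:
  fixes V U :: "'u frame set"
  assumes inf: "infinite (UNIV :: 'u set)"
    and V: "variety V" "\<forall>A\<in>V. normal A \<and> unit_preserving A"
    and U: "variety U" "\<forall>A\<in>U. normal A \<and> unit_preserving A"
    and sub: "star_variety U \<subseteq> star_variety V"
  shows "U \<subseteq> V"
proof
  fix A assume A: "A \<in> U"
  have bfU: "\<forall>A\<in>U. boolean_frame A" and bfV: "\<forall>A\<in>V. boolean_frame A"
    and HV: "HSP V = V" using U V by (auto simp: variety_def)
  show "A \<in> V"
  proof (cases "one A = zero A")
    case True
    then show ?thesis using HSP_trivial[of A V] HV bfU A by auto
  next
    case False
    obtain E p a where E: "E \<in> U" "hom_onto p E A" "a \<in> univ E" "a \<noteq> zero E" "a \<noteq> one E"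
      "oper E a = a"
      using variety_contains_square[OF inf U A False] by metis
    obtain \<phi> :: "'u \<times> 'u \<Rightarrow> 'u" where \<phi>: "inj \<phi>" using inj_pairing_exists[OF inf] .
    have "transport \<phi> (star E) \<in> HSP (star ` V)"
      using star_copy_in_star_variety[OF \<phi>] E(1) bfU sub by (auto simp: star_variety_def)
    then have "star E \<in> HSP (star ` V)" using HSP_hom transport_hom(2)[OF \<phi>] by blast
    then have "E \<in> HSP V"
      using star_reflects_HSP[of V E a] E bfU bfV U(2) V(2) by auto
    then show ?thesis using HSP_hom[OF _ E(2), of V] HV by simp
  qed
qed

section \<open>Failure of the congruence extension property\<close>

text \<open>Stated abstractly so as to apply to a copy of a star: \<open>c\<close> stands for (1,
  0), and \<open>p\<close> and \<open>q\<close> for (0, a) and (0, -a).\<close>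

lemma not_has_CEP:
  assumes S: "boolean_frame S"
    and c: "c \<in> univ S" "c \<noteq> one S" "oper S c = c" "oper S (compl S c) = compl S c"
    and n: "oper S (zero S) = zero S" "oper S (one S) = one S"
    and p: "p \<in> univ S" "q \<in> univ S" "meet S p q = zero S" "oper S p = p" "oper S q = q"
    and j: "oper S (join S c p) = one S" "oper S (join S c q) = one S"
  shows "\<not> has_CEP S"
proof
  assume CEP: "has_CEP S"
  note s = boolean_frame_simps[OF S]
  define C where "C = {zero S, one S, c, compl S c}"
  have cc: "meet S (compl S c) c = zero S"
    using meet_comm[OF S s(2)[OF c(1)] c(1)] s(5)[OF c(1)] by simp
  have C: "subuniverse C S"
    using c n by (auto simp: subuniverse_def C_def s cc)
  have ne: "zero S \<noteq> compl S c" using c(2) s(13)[OF c(1)] s(7) by auto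
  have ne1: "zero S \<noteq> one S" using trivial_of_one_eq_zero[OF S _ c(1)] c(2) by auto
  \<comment> \<open>The congruence collapsing \<open>c\<close> to 0 on the generated subalgebra has
    two blocks: \<open>L\<close> around 0 and \<open>M\<close> around 1.\<close>
  define L M where "L = {zero S, c}" and "M = {one S, compl S c}"
  define \<Theta> where "\<Theta> = L \<times> L \<union> M \<times> M"
  have disj: "L \<inter> M = {}"
    using ne ne1 c(2) meet_idem[OF S c(1)] s(5)[OF c(1)] by (auto simp: L_def M_def)
  have CLM: "C = L \<union> M" by (auto simp: C_def L_def M_def)
  have LM: "x \<in> L \<Longrightarrow> compl S x \<in> M" "x \<in> M \<Longrightarrow> compl S x \<in> L"
    "x \<in> L \<Longrightarrow> oper S x \<in> L" "x \<in> M \<Longrightarrow> oper S x \<in> M"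
    "x \<in> L \<Longrightarrow> y \<in> L \<union> M \<Longrightarrow> meet S x y \<in> L" "x \<in> M \<Longrightarrow> y \<in> L \<Longrightarrow> meet S x y \<in> L"
    "x \<in> M \<Longrightarrow> y \<in> M \<Longrightarrow> meet S x y \<in> M" for x y
    using c n by (auto simp: L_def M_def s cc)
  have "congruence (S\<lparr>univ := C\<rparr>) \<Theta>"
    unfolding congruence_def
  proof (intro conjI allI impI)
    show "equiv (univ (S\<lparr>univ := C\<rparr>)) \<Theta>"
      using disj by (intro equivI) (auto simp: CLM \<Theta>_def refl_on_def sym_def trans_def)
  qed (auto simp: \<Theta>_def intro: LM)
  moreover have "subalgebra (S\<lparr>univ := C\<rparr>) S" using C by (auto simp: subalgebra_def)
  ultimately obtain \<Psi> where \<Psi>: "congruence S \<Psi>" "\<Psi> \<inter> (C \<times> C) = \<Theta>"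
    using CEP by (fastforce simp: has_CEP_def)
  have refl: "(x, x) \<in> \<Psi>" if "x \<in> univ S" for x
    using \<Psi>(1) that by (auto simp: congruence_def equiv_def refl_on_def)
  have cong: "(x, y) \<in> \<Psi> \<Longrightarrow> (compl S x, compl S y) \<in> \<Psi>" "(x, y) \<in> \<Psi> \<Longrightarrow> (oper S x, oper S y) \<in> \<Psi>"
    "(x, y) \<in> \<Psi> \<Longrightarrow> (z, w) \<in> \<Psi> \<Longrightarrow> (meet S x z, meet S y w) \<in> \<Psi>" for x y z w
    using \<Psi>(1) by (auto simp: congruence_def)
  have "(zero S, c) \<in> \<Psi>" using \<Psi>(2) by (auto simp: \<Theta>_def L_def)
  \<comment> \<open>Joining \<open>r\<close> to the congruent pair 0, \<open>c\<close> and applying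
    the operation relates f(r) to f(c join r); for \<open>p\<close> and \<open>q\<close> the latter
    is 1.\<close>
  then have "(oper S (join S (zero S) r), oper S (join S c r)) \<in> \<Psi>" if "r \<in> univ S" for r
    unfolding join_def using that by (intro cong refl) (auto simp: s)
  moreover have "join S (zero S) r = r" if "r \<in> univ S" for r
    using that by (simp add: join_def s)
  ultimately have "(oper S r, oper S (join S c r)) \<in> \<Psi>" if "r \<in> univ S" for r
    using that by fastforce
  from this[OF p(1)] this[OF p(2)] have "(p, one S) \<in> \<Psi>" "(q, one S) \<in> \<Psi>"
    using p j by simp_all
  from cong(3)[OF this] have "(zero S, one S) \<in> \<Psi>" using p by (simp add: s)
  then have "(zero S, one S) \<in> \<Theta>" using \<Psi>(2) by (auto simp: C_def)
  then show False using disj by (auto simp: \<Theta>_def L_def M_def)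
qed

lemma star_variety_lacks_CEP:
  fixes V :: "'u frame set"
  assumes inf: "infinite (UNIV :: 'u set)"
    and V: "variety V" "\<forall>A\<in>V. normal A \<and> unit_preserving A"
    and "nontrivial V"
  shows "lacks_CEP (star_variety V)"
proof -
  have bfV: "\<forall>A\<in>V. boolean_frame A" using V by (auto simp: variety_def)
  obtain A x y where xy: "A \<in> V" "x \<in> univ A" "y \<in> univ A" "x \<noteq> y"
    using assms(4) unfolding nontrivial_def by blast
  then have A: "A \<in> V" "one A \<noteq> zero A"
    using trivial_of_one_eq_zero[of A x] trivial_of_one_eq_zero[of A y] bfV by auto
  obtain E p a where E: "E \<in> V" "a \<in> univ E" "a \<noteq> zero E" "a \<noteq> one E"
    "oper E a = a" "oper E (compl E a) = compl E a"
    using variety_contains_square[OF inf V A] by blast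
  have bf: "boolean_frame E" and n: "oper E (zero E) = zero E" "oper E (one E) = one E"
    using V E(1) by (auto simp: variety_def normal_def unit_preserving_def)
  note e = boolean_frame_simps[OF bf]
  have ne: "one E \<noteq> zero E" using trivial_of_one_eq_zero[OF bf _ E(2)] E(3) by blast
  have nc: "compl E a \<noteq> zero E" using E(4) e(13)[OF E(2)] e(7) by auto
  obtain \<phi> :: "'u \<times> 'u \<Rightarrow> 'u" where \<phi>: "inj \<phi>" using inj_pairing_exists[OF inf] .
  define S where "S = transport \<phi> (star E)"
  note hom = transport_hom(1)[OF \<phi>, of "star E", folded S_def]
  have bfS: "boolean_frame S" using boolean_frame_hom_onto[OF boolean_frame_star[OF bf] hom] .
  note H = hom_ontoD[OF hom]
  have oS: "one S = \<phi> (one E, one E)"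
    unfolding one_def[of S] H(1)[symmetric] using H(2)[of "zero (star E)"]
    by (simp add: star_simps e)
  have H': "zero S = \<phi> (zero E, zero E)"
    "x \<in> univ E \<Longrightarrow> y \<in> univ E \<Longrightarrow> compl S (\<phi> (x, y)) = \<phi> (compl E x, compl E y)"
    "x \<in> univ E \<Longrightarrow> y \<in> univ E \<Longrightarrow> oper S (\<phi> (x, y)) = \<phi> (oper (star E) (x, y))"
    "x \<in> univ E \<Longrightarrow> y \<in> univ E \<Longrightarrow> u \<in> univ E \<Longrightarrow> v \<in> univ E \<Longrightarrow>
      meet S (\<phi> (x, y)) (\<phi> (u, v)) = \<phi> (meet E x u, meet E y v)"
    "x \<in> univ E \<Longrightarrow> y \<in> univ E \<Longrightarrow> \<phi> (x, y) \<in> univ S" for x y u v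
    using H(1) H(2)[of "(x, y)"] H(3)[of "(x, y)"] H(4)[of "(x, y)" "(u, v)"] H(5)[of "(x, y)"]
    by (simp_all add: star_simps)
  have \<phi>_eq: "\<phi> x = \<phi> y \<longleftrightarrow> x = y" for x y using \<phi> by (rule inj_eq)
  have "\<not> has_CEP S"
    \<comment> \<open>The joins are (1, a) and (1, -a). All their coordinates are nonzero because
      \<open>a\<close> is neither 0 nor 1, so the operation sends both to (1, 1).\<close>
    by (rule not_has_CEP[OF bfS, of "\<phi> (one E, zero E)" "\<phi> (zero E, a)" "\<phi> (zero E, compl E a)"])
       (simp_all add: H' oS e join_def star_simps \<phi>_eq E ne ne[symmetric] nc n)
  then show ?thesis
    using star_copy_in_star_variety[OF \<phi> bf E(1)] by (auto simp: lacks_CEP_def S_def)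
qed

theorem theorem2p13:
  fixes V U :: "'u frame set"
  assumes "infinite (UNIV :: 'u set)"
    and "variety V" and "\<forall>A\<in>V. normal A \<and> unit_preserving A"
    and "variety U" and "\<forall>A\<in>U. normal A \<and> unit_preserving A"
    and "V \<noteq> U"
  shows "variety (star_variety V) \<and> variety (star_variety U) \<and>
         star_variety V \<noteq> star_variety U \<and>
         (nontrivial V \<longrightarrow> lacks_CEP (star_variety V)) \<and>
         (nontrivial U \<longrightarrow> lacks_CEP (star_variety U))"
proof (intro conjI impI)
  have "variety (star_variety W)" if "variety W" for W :: "'u frame set"
    unfolding star_variety_def
    by (rule variety_HSP) (use that boolean_frame_star in \<open>auto simp: variety_def\<close>)
  then show "variety (star_variety V)" "variety (star_variety U)" using assms by auto
  \<comment> \<open>Equal star varieties would be included in each other, and both inclusions are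
    reflected to \<open>V\<close> and \<open>U\<close>.\<close>
  show "star_variety V \<noteq> star_variety U"
    using star_variety_subset_reflects[OF assms(1-3) assms(4,5)]
      star_variety_subset_reflects[OF assms(1) assms(4,5) assms(2,3)] assms(6) by blast
qed (use star_variety_lacks_CEP[OF assms(1-3)] star_variety_lacks_CEP[OF assms(1,4,5)] in auto)

end
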